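(* Let $R,S$ be commutative unital rings, $\pi:R\to S$ a ring homomorphism and $f:Spec(R)\to Spec(S)$ a homeomorphism with inverse $g$. Then $(\mathcal{RI}(R),\nabla,\to)$, with $\nabla I=\hat f(\pi_*(I))$ and $I\to J=\pi^{-1}(\hat g([J:I]))$, is a normal $\nabla$-algebra. Moreover: - it is faithful iff for every $s\in S$ there exist $r_1,\dots,r_k\in R$ and $m\ge0$ with $s\mid\pi(r_i)$ for all $i$ and $s^m=\sum_{i=1}^ks_i\pi(r_i)$ for some $s_i\in S$; - it is full iff for every $A\cup\{r\}\subseteq R$, $\pi(r)\in\langle\pi[A]\rangle$ implies $r^n\in\langle A\rangle$ for some $n\ge0$.
   Context: \textbf{Rings.} For a commutative unital ring $R$: - $\langle A\rangle$ is the ideal generated by $A$. - $Rad(I)=\{x\mid\exists n,x^n\in I\}$ and $\mathcal{RI}(R)$ is the lattice (under $\subseteq$) of radical ideals. - $[J:I]=\{x\mid\forall y\in I,\ xy\in J\}$. - $Spec(R)$ is the set of prime ideals with topology generated by $U_r=\{P\mid r\notin P\}$. - $\mathcal{I}:\mathcal{O}(Spec(R))\to\mathcal{RI}(R)$ is $\mathcal{I}(U)=\{r\mid\forall P\notin U,\ r\in P\}$, and $\mathcal{U}:\mathcal{RI}(R)\to\mathcal{O}(Spec(R))$ is $\mathcal{U}(I)=\{P\mid\exists x\in I,\ x\notin P\}$; these are mutually inverse isomorphisms. - For a continuous $F:Spec(R)\to Spec(S)$, $\hat F:\mathcal{RI}(S)\to\mathcal{RI}(R)$ is $\hat F=\mathcal{I}\circ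 F^{-1}\circ\mathcal{U}$. - For a ring homomorphism $\pi:R\to S$, $\pi_*:\mathcal{RI}(R)\to\mathcal{RI}(S)$ is $\pi_*(I)=Rad(\langle\pi[I]\rangle)$ and $\pi^{-1}:\mathcal{RI}(S)\to\mathcal{RI}(R)$ is the preimage. \textbf{$\nabla$-algebras.} A $\nabla$-algebra is $(\mathsf{A},\nabla,\to)$ with $\mathsf{A}$ a bounded lattice and $\nabla c\wedge a\le b$ iff $c\le a\to b$. It is: - normal if $\nabla1=1$ and $\nabla(a\wedge b)=\nabla a\wedge\nabla b$; - faithful if $\nabla$ is surjective; - full if $a\mapsto1\to a$ is surjective (equivalently $\nabla$ injective). *)

theory Defs
  imports "HOL-Algebra.Algebra" "HOL-Analysis.Analysis"
begin

definition radical :: "('a, 'm) ring_scheme \<Rightarrow> 'a set \<Rightarrow> 'a set" where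
  "radical R I = {x \<in> carrier R. \<exists>n::nat. x [^]\<^bsub>R\<^esub> n \<in> I}"

text \<open>The improper ideal counts as a radical ideal.\<close>
definition radical_ideals :: "('a, 'm) ring_scheme \<Rightarrow> 'a set set" where
  "radical_ideals R = {I. ideal I R \<and> radical R I = I}"

definition RI :: "('a, 'm) ring_scheme \<Rightarrow> 'a set gorder" where
  "RI R = \<lparr>carrier = radical_ideals R, eq = (=), le = (\<subseteq>)\<rparr>"

text \<open>The ideal quotient \<open>[J : I]\<close>.\<close>
definition ideal_quotient :: "('a, 'm) ring_scheme \<Rightarrow> 'a set \<Rightarrow> 'a set \<Rightarrow> 'a set" where
  "ideal_quotient R J I = {x \<in> carrier R. \<forall>y\<in>I. x \<otimes>\<^bsub>R\<^esub> y \<in> J}"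

definition Spec :: "('a, 'm) ring_scheme \<Rightarrow> 'a set set" where
  "Spec R = {P. primeideal P R}"

definition Spec_topology :: "('a, 'm) ring_scheme \<Rightarrow> 'a set topology" where
  "Spec_topology R = topology_generated_by ((\<lambda>r. {P \<in> Spec R. r \<notin> P}) ` carrier R)"

lemma topspace_Spec_topology:
  assumes "cring R"
  shows "topspace (Spec_topology R) = Spec R"
proof -
  interpret cring R by fact
  have "\<one>\<^bsub>R\<^esub> \<notin> P" if "P \<in> Spec R" for P
    using that ideal.one_imp_carrier[of P R]
    by (auto simp: Spec_def primeideal_def primeideal_axioms_def)
  then show ?thesis
    unfolding Spec_topology_def topology_generated_by_topspace by auto
qed

definition ideal_of :: "('a, 'm) ring_scheme \<Rightarrow> 'a set set \<Rightarrow> 'a set" where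
  "ideal_of R U = {r \<in> carrier R. \<forall>P \<in> Spec R. P \<notin> U \<longrightarrow> r \<in> P}"

definition open_of :: "('a, 'm) ring_scheme \<Rightarrow> 'a set \<Rightarrow> 'a set set" where
  "open_of R I = {P \<in> Spec R. \<exists>x\<in>I. x \<notin> P}"

text \<open>For \<open>F : Spec R \<rightarrow> Spec S\<close>, the map \<open>hat R S F\<close> goes from the radical ideals of \<open>S\<close>
  to those of \<open>R\<close>.\<close>
definition hat ::
  "('a, 'm) ring_scheme \<Rightarrow> ('b, 'n) ring_scheme \<Rightarrow> ('a set \<Rightarrow> 'b set) \<Rightarrow> 'b set \<Rightarrow> 'a set" where
  "hat R S F J = ideal_of R {P \<in> Spec R. F P \<in> open_of S J}"

definition push_ideal :: "('b, 'n) ring_scheme \<Rightarrow> ('a \<Rightarrow> 'b) \<Rightarrow> 'a set \<Rightarrow> 'b set" where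
  "push_ideal S \<pi> I = radical S (Idl\<^bsub>S\<^esub> (\<pi> ` I))"

definition pull_ideal :: "('a, 'm) ring_scheme \<Rightarrow> ('a \<Rightarrow> 'b) \<Rightarrow> 'b set \<Rightarrow> 'a set" where
  "pull_ideal R \<pi> J = {x \<in> carrier R. \<pi> x \<in> J}"

locale nabla_algebra = bounded_lattice L for L (structure) +
  fixes nabla :: "'a \<Rightarrow> 'a" and imp :: "'a \<Rightarrow> 'a \<Rightarrow> 'a"
  assumes nabla_closed: "a \<in> carrier L \<Longrightarrow> nabla a \<in> carrier L"
    and imp_closed: "\<lbrakk>a \<in> carrier L; b \<in> carrier L\<rbrakk> \<Longrightarrow> imp a b \<in> carrier L"
    and adjunction: "\<lbrakk>a \<in> carrier L; b \<in> carrier L; c \<in> carrier L\<rbrakk>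
      \<Longrightarrow> nabla c \<sqinter> a \<sqsubseteq> b \<longleftrightarrow> c \<sqsubseteq> imp a b"

locale normal_nabla_algebra = nabla_algebra +
  assumes nabla_top: "nabla \<top> = \<top>"
    and nabla_meet: "\<lbrakk>a \<in> carrier L; b \<in> carrier L\<rbrakk>
      \<Longrightarrow> nabla (a \<sqinter> b) = nabla a \<sqinter> nabla b"

locale faithful_nabla_algebra = nabla_algebra +
  assumes nabla_surj: "nabla ` carrier L = carrier L"

locale full_nabla_algebra = nabla_algebra +
  assumes imp_top_surj: "(\<lambda>a. imp \<top> a) ` carrier L = carrier L"

definition RI_nabla ::
  "('a, 'm) ring_scheme \<Rightarrow> ('b, 'n) ring_scheme \<Rightarrow> ('a \<Rightarrow> 'b) \<Rightarrow> ('a set \<Rightarrow> 'b set)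
    \<Rightarrow> 'a set \<Rightarrow> 'a set" where
  "RI_nabla R S \<pi> f I = hat R S f (push_ideal S \<pi> I)"

definition RI_imp ::
  "('a, 'm) ring_scheme \<Rightarrow> ('b, 'n) ring_scheme \<Rightarrow> ('a \<Rightarrow> 'b) \<Rightarrow> ('b set \<Rightarrow> 'a set)
    \<Rightarrow> 'a set \<Rightarrow> 'a set \<Rightarrow> 'a set" where
  "RI_imp R S \<pi> g I J = pull_ideal R \<pi> (hat S R g (ideal_quotient R J I))"

end

theory Submission
  imports Defs
begin

text \<open>
  Every radical ideal is an intersection of primes, so radical ideals correspond to open sets of
  the spectrum and the homeomorphism makes \<open>hat R S f\<close> and \<open>hat S R g\<close> mutually inverse lattice
  isomorphisms. The adjunction is then the composite of three: \<open>X \<inter> I \<subseteq> J\<close> iff \<open>X \<subseteq> [J : I]\<close> for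
  radical ideals, transport along the homeomorphism, and \<open>push_ideal\<close> left adjoint to
  \<open>pull_ideal\<close>. Hence the algebra is faithful iff \<open>push_ideal\<close> is surjective, which is tested on the
  radicals of principal ideals, and full iff \<open>pull_ideal\<close> is surjective, which by the adjunction
  says that \<open>I\<close> is recovered from its direct image.
\<close>

section \<open>Ideals of a commutative ring\<close>

text \<open>Negation is multiplication by \<open>\<ominus> \<one>\<close> and commutativity makes
  one-sided absorption enough, which reduces the later ideal checks to four conditions.\<close>

lemma (in cring) ideal_criterion:
  assumes sub: "I \<subseteq> carrier R" and zero: "\<zero> \<in> I"
    and add: "\<And>x y. \<lbrakk>x \<in> I; y \<in> I\<rbrakk> \<Longrightarrow> x \<oplus> y \<in> I"
    and mult: "\<And>a x. \<lbrakk>a \<in> carrier R; x \<in> I\<rbrakk> \<Longrightarrow> a \<otimes> x \<in> I"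
  shows "ideal I R"
proof (rule idealI)
  show "subgroup I (add_monoid R)"
  proof (rule add.subgroupI)
    fix x assume "x \<in> I"
    then have "(\<ominus> \<one>) \<otimes> x \<in> I" by (intro mult) auto
    then show "\<ominus> x \<in> I" using \<open>x \<in> I\<close> sub by (auto simp: l_minus)
  qed (use sub zero add in auto)
  show "a \<otimes> x \<in> I" if "a \<in> I" "x \<in> carrier R" for a x
    using mult[OF that(2,1)] that sub m_comm[of x a] by auto
qed (use mult in \<open>auto intro: ring_axioms\<close>)

text \<open>Taking an arbitrary subset \<open>B\<close> lets the colon be formed by single elements,
  as in the primality argument, and by image sets, as for direct images of intersections.\<close>

lemma (in cring) ideal_quotient_ideal:
  assumes J: "ideal J R" and B: "B \<subseteq> carrier R"
  shows "ideal (ideal_quotient R J B) R"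
proof -
  interpret J: ideal J R by fact
  show ?thesis
    by (rule ideal_criterion)
      (use B J.zero_closed J.a_closed J.I_l_closed in
        \<open>auto simp: ideal_quotient_def l_distr subset_iff m_assoc\<close>)
qed

lemma (in cring) ideal_subset_quotient:
  assumes "ideal J R" and "B \<subseteq> carrier R"
  shows "J \<subseteq> ideal_quotient R J B"
  using assms ideal.I_r_closed[OF assms(1)] ideal.Icarr[OF assms(1)]
  by (auto simp: ideal_quotient_def)

text \<open>The finite combinations form an ideal containing \<open>B\<close>, hence one that
  contains \<open>Idl B\<close>. This supplies the explicit sum in the faithfulness
  criterion.\<close>

lemma (in cring) genideal_finite_combination:
  assumes B: "B \<subseteq> carrier R" and x: "x \<in> Idl B"
  shows "\<exists>(k::nat) b t. (\<forall>i\<in>{1..k}. b i \<in> B \<and> t i \<in> carrier R) \<and>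
    x = (\<Oplus>i\<in>{1..k}. t i \<otimes> b i)"
proof -
  define comb where "comb k b t x \<longleftrightarrow> (\<forall>i\<in>{1..k}. b i \<in> B \<and> t i \<in> carrier R) \<and>
    x = (\<Oplus>i\<in>{1..k}. t i \<otimes> b i)" for k :: nat and b t :: "nat \<Rightarrow> 'a" and x
  define T where "T = {x. \<exists>k b t. comb k b t x}"
  have sub: "T \<subseteq> carrier R"
    using B by (auto simp: T_def comb_def subset_iff intro!: finsum_closed)
  \<comment> \<open>Appending one term at index \<open>Suc k\<close> is the basic move: it yields
    \<open>B \<subseteq> T\<close> by appending to the empty sum, and closure under addition by
    repetition.\<close>
  have snoc: "x \<oplus> c \<otimes> y \<in> T" if x: "x \<in> T" and "c \<in> carrier R" "y \<in> B" for x c y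
  proof -
    obtain k b t where kbt: "comb k b t x" using x by (auto simp: T_def)
    have "(\<Oplus>i\<in>{1..Suc k}. (t(Suc k := c)) i \<otimes> (b(Suc k := y)) i)
      = c \<otimes> y \<oplus> (\<Oplus>i\<in>{1..k}. (t(Suc k := c)) i \<otimes> (b(Suc k := y)) i)"
      unfolding atLeastAtMostSuc_conv[of 1 k, OF le_add1[of 1 k, folded Suc_eq_plus1_left]]
      by (subst finsum_insert) (use that B kbt in \<open>auto simp: comb_def subset_iff\<close>)
    also have "(\<Oplus>i\<in>{1..k}. (t(Suc k := c)) i \<otimes> (b(Suc k := y)) i) = x"
      unfolding kbt[unfolded comb_def, THEN conjunct2]
      by (rule finsum_cong') (use B kbt in \<open>auto simp: comb_def subset_iff\<close>)
    finally have "comb (Suc k) (b(Suc k := y)) (t(Suc k := c)) (x \<oplus> c \<otimes> y)"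
      using kbt that B sub by (auto simp: comb_def subset_iff a_comm)
    then show ?thesis by (auto simp: T_def)
  qed
  have zero: "\<zero> \<in> T"
    unfolding T_def by (rule CollectI, rule exI[of _ 0]) (simp add: comb_def)
  have "ideal T R"
  proof (rule ideal_criterion[OF sub zero])
    fix x y assume x: "x \<in> T" and y: "y \<in> T"
    then obtain k b t where kbt: "comb k b t y" by (auto simp: T_def)
    \<comment> \<open>The terms of \<open>y\<close> are added to \<open>x\<close> one at a time, so
      no two index families have to be concatenated.\<close>
    have "x \<oplus> (\<Oplus>i\<in>{1..n}. t i \<otimes> b i) \<in> T" if "n \<le> k" for n
      using that
    proof (induction n)
      case 0 then show ?case using x sub by auto
    next
      case (Suc n)
      have tb: "t i \<in> carrier R" "b i \<in> carrier R" if "i \<in> {1..Suc n}" for i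
        using kbt B that Suc.prems by (auto simp: comb_def subset_iff)
      have fs: "(\<Oplus>i\<in>{1..n}. t i \<otimes> b i) \<in> carrier R"
        using tb by (auto intro!: finsum_closed)
      have "(\<Oplus>i\<in>{1..Suc n}. t i \<otimes> b i) = t (Suc n) \<otimes> b (Suc n) \<oplus> (\<Oplus>i\<in>{1..n}. t i \<otimes> b i)"
        unfolding atLeastAtMostSuc_conv[of 1 n, OF le_add1[of 1 n, folded Suc_eq_plus1_left]]
        by (subst finsum_insert) (use tb in auto)
      then have "x \<oplus> (\<Oplus>i\<in>{1..Suc n}. t i \<otimes> b i)
        = (x \<oplus> (\<Oplus>i\<in>{1..n}. t i \<otimes> b i)) \<oplus> t (Suc n) \<otimes> b (Suc n)"
        using fs tb[of "Suc n"] x sub by (auto simp: a_ac subset_iff)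
      also have "\<dots> \<in> T"
        using Suc kbt by (intro snoc) (auto simp: comb_def)
      finally show ?case .
    qed
    from this[of k] show "x \<oplus> y \<in> T" using kbt by (simp add: comb_def)
  next
    fix a x assume a: "a \<in> carrier R" and "x \<in> T"
    then obtain k b t where kbt: "comb k b t x" by (auto simp: T_def)
    have "a \<otimes> x = (\<Oplus>i\<in>{1..k}. a \<otimes> (t i \<otimes> b i))"
      unfolding kbt[unfolded comb_def, THEN conjunct2]
      by (rule finsum_rdistr) (use a kbt B in \<open>auto simp: comb_def subset_iff\<close>)
    also have "\<dots> = (\<Oplus>i\<in>{1..k}. (a \<otimes> t i) \<otimes> b i)"
      by (rule finsum_cong') (use a kbt B in \<open>auto simp: comb_def subset_iff m_assoc\<close>)
    finally have "comb k b (\<lambda>i. a \<otimes> t i) (a \<otimes> x)"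
      using a kbt by (auto simp: comb_def)
    then show "a \<otimes> x \<in> T" by (auto simp: T_def)
  qed
  moreover have "B \<subseteq> T"
    using snoc[OF zero one_closed] B by (fastforce simp: subset_iff)
  ultimately have "x \<in> T" using x genideal_minimal by blast
  then show ?thesis by (auto simp: T_def comb_def)
qed

lemma (in ideal) finsum_mem:
  assumes "finite A" and "\<And>i. i \<in> A \<Longrightarrow> h i \<in> I"
  shows "(\<Oplus>i\<in>A. h i) \<in> I"
  using assms
proof (induction A)
  case (insert j A)
  then show ?case by (subst finsum_insert) (auto simp: Icarr a_closed)
qed simp

section \<open>The prime spectrum\<close>

lemma (in primeideal) pow_mem:
  assumes "x \<in> carrier R" and "x [^] (n::nat) \<in> I"
  shows "x \<in> I"
  using assms(2)
proof (induction n)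
  \<comment> \<open>Exponent zero is allowed in \<open>radical\<close>; here it would put
    \<open>\<one>\<close> into a proper ideal.\<close>
  case 0 then show ?case using one_imp_carrier I_notcarr by auto
next
  case (Suc n) then show ?case using I_prime[of "x [^] n" x] assms(1) by auto
qed

text \<open>Using the colon ideals \<open>[P : b]\<close> and \<open>[P : x^n]\<close> in place of \<open>P + (a)\<close> and \<open>P + (b)\<close> avoids
  computing with sums of ideals.\<close>

lemma (in cring) maximal_power_avoiding_is_prime:
  assumes P: "ideal P R" and x: "x \<in> carrier R"
    and avoid: "\<And>n::nat. x [^] n \<notin> P"
    and max: "\<And>Q. \<lbrakk>ideal Q R; \<And>n::nat. x [^] n \<notin> Q; P \<subseteq> Q\<rbrakk> \<Longrightarrow> Q = P"
  shows "primeideal P R"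
proof (rule primeidealI)
  show "carrier R \<noteq> P" using avoid[of 0] by auto
  \<comment> \<open>An element \<open>d\<close> of \<open>[P : c]\<close> outside \<open>P\<close>
    makes the colon ideal strictly larger than \<open>P\<close>, so maximality puts a power of
    \<open>x\<close> into it.\<close>
  have quot: "\<exists>n::nat. x [^] n \<in> ideal_quotient R P {c}"
    if "c \<in> carrier R" "d \<in> ideal_quotient R P {c}" "d \<notin> P" for c d
    using max[of "ideal_quotient R P {c}"] that
      ideal_quotient_ideal[OF P, of "{c}"] ideal_subset_quotient[OF P, of "{c}"] by auto
  fix a b assume a: "a \<in> carrier R" and b: "b \<in> carrier R" and ab: "a \<otimes> b \<in> P"
  show "a \<in> P \<or> b \<in> P"
  proof (rule ccontr)
    assume neg: "\<not> (a \<in> P \<or> b \<in> P)"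
    then obtain n :: nat where n: "x [^] n \<otimes> b \<in> P"
      using quot[of b a] a b ab by (auto simp: ideal_quotient_def)
    \<comment> \<open>The colon is now taken by \<open>x [^] n\<close>: it contains
      \<open>b\<close>, which lies outside \<open>P\<close>.\<close>
    then obtain m :: nat where "x [^] m \<otimes> x [^] n \<in> P"
      using quot[of "x [^] n" b] b x neg m_comm[of b "x [^] n"] by (auto simp: ideal_quotient_def)
    then show False using avoid[of "m + n"] x by (simp add: nat_pow_mult)
  qed
qed (use P is_cring in auto)

text \<open>Zorn's lemma gives an ideal maximal among those containing \<open>I\<close> and no power
  of \<open>x\<close>; such an ideal is prime by the preceding lemma.\<close>

lemma (in cring) exists_prime_avoiding_powers:
  assumes I: "ideal I R" and x: "x \<in> carrier R" and avoid: "\<And>n::nat. x [^] n \<notin> I"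
  shows "\<exists>P. primeideal P R \<and> I \<subseteq> P \<and> x \<notin> P"
proof -
  define A where "A = {Q. ideal Q R \<and> I \<subseteq> Q \<and> (\<forall>n::nat. x [^] n \<notin> Q)}"
  have "\<exists>P\<in>A. \<forall>Q\<in>A. P \<subseteq> Q \<longrightarrow> Q = P"
  proof (rule subset_Zorn_nonempty)
    show "A \<noteq> {}" using I avoid by (auto simp: A_def)
    fix C assume C: "C \<noteq> {}" "subset.chain A C"
    then have id: "\<And>Q. Q \<in> C \<Longrightarrow> ideal Q R" and CA: "C \<subseteq> A"
      and ch: "\<And>Q Q'. \<lbrakk>Q \<in> C; Q' \<in> C\<rbrakk> \<Longrightarrow> Q \<subseteq> Q' \<or> Q' \<subseteq> Q"
      by (auto simp: subset_chain_def A_def)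
    have sg: "additive_subgroup Q R" if "Q \<in> C" for Q using id[OF that] by (rule ideal.axioms)
    have "ideal (\<Union>C) R"
    proof (rule ideal_criterion)
      show "\<Union>C \<subseteq> carrier R" using ideal.Icarr[OF id] by blast
      show "\<zero> \<in> \<Union>C" using C(1) additive_subgroup.zero_closed[OF sg] by blast
      show "a \<otimes> y \<in> \<Union>C" if "a \<in> carrier R" "y \<in> \<Union>C" for a y
        using that ideal.I_l_closed[OF id] by blast
      fix y z assume "y \<in> \<Union>C" "z \<in> \<Union>C"
      then obtain Q where "Q \<in> C" "y \<in> Q" "z \<in> Q" using ch by blast
      then show "y \<oplus> z \<in> \<Union>C" using additive_subgroup.a_closed[OF sg] by blast
    qed
    then show "\<Union>C \<in> A" using C(1) CA by (auto simp: A_def)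
  qed
  then obtain P where P: "P \<in> A" and max: "\<And>Q. \<lbrakk>Q \<in> A; P \<subseteq> Q\<rbrakk> \<Longrightarrow> Q = P" by blast
  have "primeideal P R"
    by (rule maximal_power_avoiding_is_prime[OF _ x]) (use P in \<open>auto simp: A_def intro!: max\<close>)
  moreover have "x \<notin> P" using P nat_pow_eone[OF x] unfolding A_def by (metis (mono_tags, lifting) mem_Collect_eq)
  ultimately show ?thesis using P by (auto simp: A_def)
qed

text \<open>The right-hand side is the intersection of the primes containing \<open>I\<close>.
  Primes contain the roots of their elements, and an element with no power in \<open>I\<close> is
  left out by some prime over \<open>I\<close>.\<close>

lemma (in cring) radical_eq_ideal_of_open_of:
  assumes I: "ideal I R"
  shows "radical R I = ideal_of R (open_of R I)"
proof
  show "radical R I \<subseteq> ideal_of R (open_of R I)"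
    by (auto simp: radical_def ideal_of_def open_of_def Spec_def dest: primeideal.pow_mem)
  show "ideal_of R (open_of R I) \<subseteq> radical R I"
  proof
    fix x assume x: "x \<in> ideal_of R (open_of R I)"
    then have "\<not> (\<exists>P. primeideal P R \<and> I \<subseteq> P \<and> x \<notin> P)"
      by (auto simp: ideal_of_def open_of_def Spec_def)
    then show "x \<in> radical R I"
      using x exists_prime_avoiding_powers[OF I, of x] by (auto simp: radical_def ideal_of_def)
  qed
qed

text \<open>Intersections of primes are radical, the empty one being \<open>carrier R\<close>.
  Arbitrary \<open>U\<close> is allowed so that \<open>hat\<close> takes radical values for every
  map.\<close>

lemma (in cring) ideal_of_radical_ideal: "ideal_of R U \<in> radical_ideals R"
proof -
  have "ideal (ideal_of R U) R"
    by (rule ideal_criterion)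
      (auto simp: ideal_of_def Spec_def primeideal_def ideal.I_l_closed
        intro: additive_subgroup.a_closed additive_subgroup.zero_closed ideal.axioms(1))
  moreover have "x \<in> ideal_of R U" if "x \<in> radical R (ideal_of R U)" for x
    using that by (auto simp: radical_def ideal_of_def Spec_def dest: primeideal.pow_mem)
  moreover have "x \<in> radical R (ideal_of R U)" if "x \<in> ideal_of R U" for x
    using that nat_pow_eone[of x]
    by (auto simp: radical_def ideal_of_def intro!: exI[of _ "1::nat"])
  ultimately show ?thesis by (auto simp: radical_ideals_def)
qed

lemma (in cring) radical_radical_ideal:
  "ideal I R \<Longrightarrow> radical R I \<in> radical_ideals R"
  by (simp add: radical_eq_ideal_of_open_of ideal_of_radical_ideal)

lemma radical_ideals_ideal: "I \<in> radical_ideals R \<Longrightarrow> ideal I R"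
  by (simp add: radical_ideals_def)

lemma radical_ideals_subset: "I \<in> radical_ideals R \<Longrightarrow> I \<subseteq> carrier R"
  by (auto simp: radical_ideals_def ideal.Icarr)

lemma radical_ideals_pow_mem:
  "\<lbrakk>I \<in> radical_ideals R; x \<in> carrier R; x [^]\<^bsub>R\<^esub> (n::nat) \<in> I\<rbrakk> \<Longrightarrow> x \<in> I"
  by (auto simp: radical_ideals_def radical_def)

lemma (in cring) subset_radical: "I \<subseteq> carrier R \<Longrightarrow> I \<subseteq> radical R I"
  by (auto simp: radical_def subset_iff intro!: exI[of _ "1::nat"])

lemma (in cring) radical_idealsI:
  assumes "ideal I R" and "\<And>x n::nat. \<lbrakk>x \<in> carrier R; x [^] n \<in> I\<rbrakk> \<Longrightarrow> x \<in> I"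
  shows "I \<in> radical_ideals R"
  using assms subset_radical[of I] ideal.Icarr[OF assms(1)]
  by (auto simp: radical_ideals_def radical_def)

text \<open>This is the universal property of the least radical ideal containing \<open>A\<close>;
  it yields the adjunction between direct and inverse images.\<close>

lemma (in cring) radical_genideal_le_iff:
  assumes "J \<in> radical_ideals R" and "A \<subseteq> carrier R"
  shows "radical R (Idl A) \<subseteq> J \<longleftrightarrow> A \<subseteq> J"
proof
  assume "radical R (Idl A) \<subseteq> J"
  then show "A \<subseteq> J"
    using genideal_self[OF assms(2)] subset_radical[of "Idl A"]
      ideal.Icarr[OF genideal_ideal[OF assms(2)]] by blast
next
  assume "A \<subseteq> J"
  then have "Idl A \<subseteq> J" using genideal_minimal radical_ideals_ideal[OF assms(1)] by blast
  then show "radical R (Idl A) \<subseteq> J"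
    using radical_ideals_pow_mem[OF assms(1)] by (auto simp: radical_def)
qed

section \<open>Radical ideals and open sets of the spectrum\<close>

lemma (in cring) ideal_of_open_of:
  "I \<in> radical_ideals R \<Longrightarrow> ideal_of R (open_of R I) = I"
  using radical_eq_ideal_of_open_of[of I] by (simp add: radical_ideals_def)

lemma (in cring) openin_open_of:
  assumes "I \<subseteq> carrier R"
  shows "openin (Spec_topology R) (open_of R I)"
proof -
  have "open_of R I = (\<Union>r\<in>I. {P \<in> Spec R. r \<notin> P})" by (auto simp: open_of_def)
  also have "openin (Spec_topology R) \<dots>"
    using assms unfolding Spec_topology_def
    by (intro openin_Union) (auto intro!: topology_generated_by_Basis)
  finally show ?thesis .
qed

text \<open>The induction follows the generation of the topology. With subsets in place of ideals, a
  union of opens corresponds to a plain union and an intersection to the set of pairwise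
  products.\<close>

lemma (in cring) openin_Spec_topology_imp:
  assumes "openin (Spec_topology R) U"
  shows "\<exists>A \<subseteq> carrier R. U = open_of R A"
proof -
  have "generate_topology_on ((\<lambda>r. {P \<in> Spec R. r \<notin> P}) ` carrier R) U"
    using assms by (simp add: Spec_topology_def openin_topology_generated_by_iff)
  then show ?thesis
  proof induction
    case Empty
    then show ?case by (auto simp: open_of_def intro!: exI[of _ "{}"])
  next
    case (Int U V)
    then obtain A B where A: "A \<subseteq> carrier R" "U = open_of R A"
      and B: "B \<subseteq> carrier R" "V = open_of R B" by blast
    \<comment> \<open>This is where primality enters: \<open>P\<close> omits a product exactly when
      it omits both factors.\<close>
    have prime: "x \<otimes> y \<in> P \<longleftrightarrow> x \<in> P \<or> y \<in> P"
      if "x \<in> carrier R" "y \<in> carrier R" "P \<in> Spec R" for x y P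
    proof -
      interpret primeideal P R using that by (simp add: Spec_def)
      show ?thesis using that I_prime I_l_closed I_r_closed by blast
    qed
    have "P \<in> U \<inter> V \<longleftrightarrow> P \<in> open_of R {x \<otimes> y |x y. x \<in> A \<and> y \<in> B}" for P
    proof (cases "P \<in> Spec R")
      case True
      have "(\<exists>z\<in>{x \<otimes> y |x y. x \<in> A \<and> y \<in> B}. z \<notin> P) \<longleftrightarrow> (\<exists>x\<in>A. \<exists>y\<in>B. x \<otimes> y \<notin> P)"
        by blast
      also have "\<dots> \<longleftrightarrow> (\<exists>x\<in>A. x \<notin> P) \<and> (\<exists>y\<in>B. y \<notin> P)"
        using prime[OF _ _ True] A(1) B(1) by blast
      finally show ?thesis using True by (simp add: A B open_of_def)
    qed (simp add: A B open_of_def)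
    then have "U \<inter> V = open_of R {x \<otimes> y |x y. x \<in> A \<and> y \<in> B}" by blast
    then show ?case using A(1) B(1) by (intro exI[of _ "{x \<otimes> y |x y. x \<in> A \<and> y \<in> B}"]) auto
  next
    case (UN K)
    then have "\<forall>U\<in>K. \<exists>A. A \<subseteq> carrier R \<and> U = open_of R A" by blast
    then obtain A where A: "\<forall>U\<in>K. A U \<subseteq> carrier R \<and> U = open_of R (A U)"
      unfolding bchoice_iff by blast
    have "\<Union>K = (\<Union>U\<in>K. open_of R (A U))" using A by auto
    also have "\<dots> = open_of R (\<Union>U\<in>K. A U)" by (auto simp: open_of_def)
    finally have "\<Union>K = open_of R (\<Union>U\<in>K. A U)" .
    then show ?case using A by (intro exI[of _ "\<Union>U\<in>K. A U"]) auto
  next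
    case (Basis U)
    then obtain r where "r \<in> carrier R" "U = {P \<in> Spec R. r \<notin> P}" by auto
    then show ?case by (intro exI[of _ "{r}"]) (auto simp: open_of_def)
  qed
qed

text \<open>An element of \<open>ideal_of R U\<close> missing from \<open>P\<close> forces
  \<open>P\<close> into \<open>U\<close>. Openness gives the converse inclusion through the
  generators \<open>A\<close>, which lie in \<open>ideal_of R U\<close>.\<close>

lemma (in cring) open_of_ideal_of:
  assumes "openin (Spec_topology R) U"
  shows "open_of R (ideal_of R U) = U"
proof -
  obtain A where A: "A \<subseteq> carrier R" "U = open_of R A" using openin_Spec_topology_imp[OF assms] by blast
  then have "A \<subseteq> ideal_of R U" by (auto simp: open_of_def ideal_of_def)
  then show ?thesis using A(2) by (auto simp: open_of_def ideal_of_def)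
qed

section \<open>Transport along a homeomorphism of spectra\<close>

lemma hat_mono: "I \<subseteq> J \<Longrightarrow> hat R S f I \<subseteq> hat R S f J"
  by (auto simp: hat_def ideal_of_def open_of_def)

lemma (in cring) hat_radical_ideal: "hat R S f I \<in> radical_ideals R"
  by (simp add: hat_def ideal_of_radical_ideal)

text \<open>The inner \<open>open_of S\<close> and \<open>ideal_of S\<close> cancel because the
  preimage of an open set under the continuous \<open>g\<close> is open; what remains is the
  preimage under \<open>g\<close> after \<open>f\<close>, the identity. The other composite follows
  by exchanging the two rings.\<close>

lemma hat_hat:
  assumes R: "cring R" and S: "cring S"
    and fg: "homeomorphic_maps (Spec_topology R) (Spec_topology S) f g"
    and I: "I \<in> radical_ideals R"
  shows "hat R S f (hat S R g I) = I"
proof -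
  interpret R: cring R by fact
  interpret S: cring S by fact
  note top = topspace_Spec_topology[OF R] topspace_Spec_topology[OF S]
  have f: "f P \<in> Spec S" "g (f P) = P" if "P \<in> Spec R" for P
    using fg that by (auto simp: homeomorphic_maps_def continuous_map_def top)
  have "openin (Spec_topology S) {Q \<in> Spec S. g Q \<in> open_of R I}"
    using fg R.openin_open_of[OF radical_ideals_subset[OF I]]
    by (auto simp: homeomorphic_maps_def continuous_map_def top)
  then have "open_of S (hat S R g I) = {Q \<in> Spec S. g Q \<in> open_of R I}"
    unfolding hat_def by (rule S.open_of_ideal_of)
  then have "hat R S f (hat S R g I) = ideal_of R {P \<in> Spec R. f P \<in> Spec S \<and> g (f P) \<in> open_of R I}"
    by (simp add: hat_def)
  also have "{P \<in> Spec R. f P \<in> Spec S \<and> g (f P) \<in> open_of R I} = open_of R I"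
    using f by (auto simp: open_of_def)
  finally show ?thesis using R.ideal_of_open_of[OF I] by simp
qed

section \<open>The lattice of radical ideals\<close>

lemma RI_simps [simp]:
  "carrier (RI R) = radical_ideals R" "le (RI R) = (\<subseteq>)" "eq (RI R) = (=)"
  by (simp_all add: RI_def)

lemma RI_partial_order: "partial_order (RI R)"
  by unfold_locales auto

lemma (in cring) Inter_radical_ideals:
  assumes "A \<subseteq> radical_ideals R" and "A \<noteq> {}"
  shows "\<Inter>A \<in> radical_ideals R"
proof (rule radical_idealsI)
  show "ideal (\<Inter>A) R" by (rule i_Intersect) (use assms radical_ideals_ideal in auto)
  fix x and n :: nat assume "x \<in> carrier R" and "x [^] n \<in> \<Inter>A"
  then show "x \<in> \<Inter>A" using assms(1) by (auto dest: radical_ideals_pow_mem)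
qed

lemma (in cring) carrier_radical_ideal: "carrier R \<in> radical_ideals R"
  by (rule radical_idealsI) (auto intro: oneideal)

text \<open>A greatest element and nonempty intersections make the order complete, so joins and the
  bottom exist without being computed.\<close>

lemma (in cring) RI_bounded_lattice: "bounded_lattice (RI R)"
proof -
  interpret partial_order "RI R" by (rule RI_partial_order)
  interpret complete_lattice "RI R"
  proof (rule complete_lattice_criterion1)
    show "\<exists>g. greatest (RI R) g (carrier (RI R))"
      using carrier_radical_ideal radical_ideals_subset by (auto simp: greatest_def)
    fix A assume "A \<subseteq> carrier (RI R)" "A \<noteq> {}"
    then have "greatest (RI R) (\<Inter>A) (Lower (RI R) A)"
      using Inter_radical_ideals[of A] by (auto simp: greatest_def Lower_def)
    then show "\<exists>i. greatest (RI R) i (Lower (RI R) A)" ..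
  qed
  show ?thesis ..
qed

lemma (in cring) RI_top: "\<top>\<^bsub>RI R\<^esub> = carrier R"
proof -
  interpret bounded_lattice "RI R" by (rule RI_bounded_lattice)
  show ?thesis
    by (rule top_eq[symmetric]) (simp_all add: carrier_radical_ideal radical_ideals_subset)
qed

lemma (in cring) Int_radical_ideals:
  "\<lbrakk>I \<in> radical_ideals R; J \<in> radical_ideals R\<rbrakk> \<Longrightarrow> I \<inter> J \<in> radical_ideals R"
  using Inter_radical_ideals[of "{I, J}"] by simp

text \<open>The abstract meet is known only as a greatest lower bound; identifying it turns
  normality and the adjunction into statements about sets.\<close>

lemma (in cring) RI_meet:
  assumes "I \<in> radical_ideals R" and "J \<in> radical_ideals R"
  shows "I \<sqinter>\<^bsub>RI R\<^esub> J = I \<inter> J"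
proof -
  interpret bounded_lattice "RI R" by (rule RI_bounded_lattice)
  have m: "I \<sqinter>\<^bsub>RI R\<^esub> J \<in> radical_ideals R" "I \<sqinter>\<^bsub>RI R\<^esub> J \<subseteq> I" "I \<sqinter>\<^bsub>RI R\<^esub> J \<subseteq> J"
    using meet_closed[of I J] meet_left[of I J] meet_right[of I J] assms by simp_all
  moreover have "I \<inter> J \<subseteq> I \<sqinter>\<^bsub>RI R\<^esub> J"
    using meet_le[of "I \<inter> J" I J] assms Int_radical_ideals by simp
  ultimately show ?thesis by blast
qed

lemma (in cring) ideal_quotient_radical_ideal:
  assumes J: "J \<in> radical_ideals R" and B: "B \<subseteq> carrier R"
  shows "ideal_quotient R J B \<in> radical_ideals R"
proof (rule radical_idealsI)
  interpret J: ideal J R using J by (rule radical_ideals_ideal)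
  show "ideal (ideal_quotient R J B) R"
    using J.is_ideal B by (rule ideal_quotient_ideal)
  fix x and n :: nat assume x: "x \<in> carrier R" and xn: "x [^] n \<in> ideal_quotient R J B"
  have "x \<otimes> y \<in> J" if "y \<in> B" for y
  proof -
    have y: "y \<in> carrier R" using that B by auto
    \<comment> \<open>The exponent \<open>Suc n\<close> secures a factor \<open>y\<close> beside
      \<open>x [^] n\<close> even for \<open>n = 0\<close>; their product lies in \<open>J\<close>
      and absorbs the rest.\<close>
    have "(x \<otimes> y) [^] Suc n = (x [^] n \<otimes> y) \<otimes> (x \<otimes> y [^] n)"
      using x y by (simp add: nat_pow_distrib m_ac)
    also have "\<dots> \<in> J"
      by (rule J.I_r_closed) (use xn that x y in \<open>auto simp: ideal_quotient_def\<close>)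
    finally show ?thesis using radical_ideals_pow_mem[OF J] x y by blast
  qed
  then show "x \<in> ideal_quotient R J B" using x by (simp add: ideal_quotient_def)
qed

text \<open>One direction uses that products lie in both ideals. The other tests the colon on
  \<open>x\<close> itself: \<open>x \<otimes> x \<in> B\<close> implies \<open>x \<in> B\<close>
  because \<open>B\<close> is radical.\<close>

lemma (in cring) radical_ideal_Int_le_iff:
  assumes "I \<in> radical_ideals R" and "A \<in> radical_ideals R" and "B \<in> radical_ideals R"
  shows "I \<inter> A \<subseteq> B \<longleftrightarrow> I \<subseteq> ideal_quotient R B A"
proof
  note sub = radical_ideals_subset[OF assms(1)] radical_ideals_subset[OF assms(2)]
  interpret I: ideal I R using assms(1) by (rule radical_ideals_ideal)
  interpret A: ideal A R using assms(2) by (rule radical_ideals_ideal)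
  show "I \<subseteq> ideal_quotient R B A" if le: "I \<inter> A \<subseteq> B"
  proof
    fix x assume x: "x \<in> I"
    have "x \<otimes> y \<in> B" if "y \<in> A" for y
    proof -
      have "x \<otimes> y \<in> I" using x that sub by (intro I.I_r_closed) auto
      moreover have "x \<otimes> y \<in> A" using x that sub by (intro A.I_l_closed) auto
      ultimately show ?thesis using le by blast
    qed
    then show "x \<in> ideal_quotient R B A" using x sub by (auto simp: ideal_quotient_def)
  qed
  show "I \<inter> A \<subseteq> B" if le: "I \<subseteq> ideal_quotient R B A"
  proof
    fix x assume "x \<in> I \<inter> A"
    then have "x \<in> carrier R" "x \<otimes> x \<in> B" using le by (auto simp: ideal_quotient_def)
    then show "x \<in> B"
      using radical_ideals_pow_mem[OF assms(3), of x 2] by (simp add: numeral_2_eq_2)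
  qed
qed

text \<open>Evaluation at \<open>\<one>\<close> gives one inclusion. At the top element the
  implication thus loses its colon, so that fullness becomes a property of
  \<open>pull_ideal\<close>.\<close>

lemma (in cring) ideal_quotient_carrier:
  assumes "ideal J R"
  shows "ideal_quotient R J (carrier R) = J"
proof
  show "ideal_quotient R J (carrier R) \<subseteq> J"
    by (auto simp: ideal_quotient_def dest: bspec[OF _ one_closed])
  show "J \<subseteq> ideal_quotient R J (carrier R)"
    using assms by (rule ideal_subset_quotient) simp
qed

section \<open>Direct and inverse images of radical ideals\<close>

context ring_hom_cring
begin

lemma image_subset_carrier: "I \<subseteq> carrier R \<Longrightarrow> h ` I \<subseteq> carrier S"
  by auto

lemma push_ideal_radical_ideal:
  "I \<subseteq> carrier R \<Longrightarrow> push_ideal S h I \<in> radical_ideals S"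
  unfolding push_ideal_def
  by (intro S.radical_radical_ideal S.genideal_ideal image_subset_carrier)

lemma pull_ideal_ideal:
  assumes "ideal J S"
  shows "ideal (pull_ideal R h J) R"
proof -
  interpret J: ideal J S by fact
  show ?thesis
    by (rule R.ideal_criterion)
      (auto simp: pull_ideal_def J.I_l_closed intro: J.zero_closed J.a_closed)
qed

lemma pull_ideal_radical_ideal:
  assumes J: "J \<in> radical_ideals S"
  shows "pull_ideal R h J \<in> radical_ideals R"
proof (rule R.radical_idealsI)
  show "ideal (pull_ideal R h J) R" using radical_ideals_ideal[OF J] by (rule pull_ideal_ideal)
  fix x and n :: nat assume x: "x \<in> carrier R" and "x [^] n \<in> pull_ideal R h J"
  then have "h x [^]\<^bsub>S\<^esub> n \<in> J" by (simp add: pull_ideal_def ring.hom_nat_pow)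
  then show "x \<in> pull_ideal R h J"
    using x radical_ideals_pow_mem[OF J] by (auto simp: pull_ideal_def)
qed

text \<open>Since \<open>J\<close> is radical, both sides say that \<open>h\<close> maps
  \<open>I\<close> into \<open>J\<close>.\<close>

lemma push_ideal_le_iff:
  assumes "I \<subseteq> carrier R" and "J \<in> radical_ideals S"
  shows "push_ideal S h I \<subseteq> J \<longleftrightarrow> I \<subseteq> pull_ideal R h J"
  unfolding push_ideal_def
  using assms S.radical_genideal_le_iff[OF assms(2) image_subset_carrier[OF assms(1)]]
  by (auto simp: pull_ideal_def)

lemma image_subset_push_ideal: "I \<subseteq> carrier R \<Longrightarrow> h ` I \<subseteq> push_ideal S h I"
  using push_ideal_le_iff[OF _ push_ideal_radical_ideal, of I I] by (auto simp: pull_ideal_def)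

lemma push_ideal_mono:
  assumes "I \<subseteq> J" and "J \<subseteq> carrier R"
  shows "push_ideal S h I \<subseteq> push_ideal S h J"
  using push_ideal_le_iff[OF _ push_ideal_radical_ideal[OF assms(2)], of I]
    image_subset_push_ideal[OF assms(2)] assms by (auto simp: pull_ideal_def)

text \<open>An element with powers in the extensions of \<open>I\<close> and of \<open>J\<close> has
  the product of these powers in the extension of \<open>I \<inter> J\<close>, because products of
  elements of \<open>I\<close> and \<open>J\<close> lie in both ideals.\<close>

lemma push_ideal_Int:
  assumes I: "ideal I R" and J: "ideal J R"
  shows "push_ideal S h (I \<inter> J) = push_ideal S h I \<inter> push_ideal S h J"
proof
  interpret I: ideal I R by fact
  interpret J: ideal J R by fact
  have IJ: "I \<subseteq> carrier R" "J \<subseteq> carrier R" using I.Icarr J.Icarr by auto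
  show "push_ideal S h (I \<inter> J) \<subseteq> push_ideal S h I \<inter> push_ideal S h J"
    using push_ideal_mono IJ by simp
  let ?K = "Idl\<^bsub>S\<^esub> (h ` (I \<inter> J))"
  have K: "ideal ?K S" and hK: "h ` (I \<inter> J) \<subseteq> ?K"
    using IJ by (auto intro!: S.genideal_ideal S.genideal_self)
  \<comment> \<open>Colon ideals carry the claim about products from generators to ideals in two
    passes, first for \<open>I\<close> and then, with the factors exchanged, for
    \<open>J\<close>.\<close>
  have "h ` I \<subseteq> ideal_quotient S ?K (h ` J)"
  proof -
    have "h x \<otimes>\<^bsub>S\<^esub> h y \<in> ?K" if "x \<in> I" "y \<in> J" for x y
    proof -
      have "x \<otimes>\<^bsub>R\<^esub> y \<in> I \<inter> J" using that I.I_r_closed J.I_l_closed IJ by blast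
      then have "h (x \<otimes>\<^bsub>R\<^esub> y) \<in> ?K" using hK by blast
      then show ?thesis using that IJ by (simp add: subset_iff)
    qed
    then show ?thesis using IJ by (auto simp: ideal_quotient_def)
  qed
  then have 1: "Idl\<^bsub>S\<^esub> (h ` I) \<subseteq> ideal_quotient S ?K (h ` J)"
    by (intro S.genideal_minimal S.ideal_quotient_ideal K image_subset_carrier IJ)
  have IdlI: "Idl\<^bsub>S\<^esub> (h ` I) \<subseteq> carrier S"
    using 1 by (auto simp: ideal_quotient_def)
  have "h ` J \<subseteq> ideal_quotient S ?K (Idl\<^bsub>S\<^esub> (h ` I))"
  proof
    fix y assume y: "y \<in> h ` J"
    then have yS: "y \<in> carrier S" using IJ by auto
    have "y \<otimes>\<^bsub>S\<^esub> x \<in> ?K" if x: "x \<in> Idl\<^bsub>S\<^esub> (h ` I)" for x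
      using subsetD[OF 1 x] y yS S.m_comm[of y x] by (auto simp: ideal_quotient_def)
    then show "y \<in> ideal_quotient S ?K (Idl\<^bsub>S\<^esub> (h ` I))" using yS by (simp add: ideal_quotient_def)
  qed
  then have 2: "Idl\<^bsub>S\<^esub> (h ` J) \<subseteq> ideal_quotient S ?K (Idl\<^bsub>S\<^esub> (h ` I))"
    by (intro S.genideal_minimal S.ideal_quotient_ideal K IdlI)
  show "push_ideal S h I \<inter> push_ideal S h J \<subseteq> push_ideal S h (I \<inter> J)"
  proof
    fix x assume "x \<in> push_ideal S h I \<inter> push_ideal S h J"
    then obtain n m :: nat where x: "x \<in> carrier S"
      and n: "x [^]\<^bsub>S\<^esub> n \<in> Idl\<^bsub>S\<^esub> (h ` I)" and m: "x [^]\<^bsub>S\<^esub> m \<in> Idl\<^bsub>S\<^esub> (h ` J)"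
      by (auto simp: push_ideal_def radical_def)
    have "x [^]\<^bsub>S\<^esub> m \<otimes>\<^bsub>S\<^esub> x [^]\<^bsub>S\<^esub> n \<in> ?K"
      using subsetD[OF 2 m] n by (auto simp: ideal_quotient_def)
    then have "x [^]\<^bsub>S\<^esub> (m + n) \<in> ?K" using x by (simp add: S.nat_pow_mult)
    then show "x \<in> push_ideal S h (I \<inter> J)" using x by (auto simp: push_ideal_def radical_def)
  qed
qed

lemma push_ideal_carrier: "push_ideal S h (carrier R) = carrier S"
proof -
  have "\<one>\<^bsub>S\<^esub> \<in> push_ideal S h (carrier R)"
    using image_subset_push_ideal[of "carrier R"] imageI[OF R.one_closed, of h] by auto
  then show ?thesis
    using ideal.one_imp_carrier radical_ideals_ideal push_ideal_radical_ideal by blast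
qed

text \<open>In ideal terms the criterion places each \<open>s\<close> in the direct image of the set
  of \<open>r\<close> with \<open>h r\<close> divisible by \<open>s\<close>; nilpotent
  \<open>s\<close> are covered by \<open>k = 0\<close>. Under it every radical \<open>J\<close> is
  the direct image of its own inverse image.\<close>

lemma push_ideal_surj_iff:
  "push_ideal S h ` radical_ideals R = radical_ideals S \<longleftrightarrow>
    (\<forall>s \<in> carrier S. \<exists>(k::nat) (r :: nat \<Rightarrow> 'a) (t :: nat \<Rightarrow> 'c) (m::nat).
      (\<forall>i \<in> {1..k}. r i \<in> carrier R \<and> t i \<in> carrier S \<and> s divides\<^bsub>S\<^esub> h (r i)) \<and>
      s [^]\<^bsub>S\<^esub> m = (\<Oplus>\<^bsub>S\<^esub>i\<in>{1..k}. t i \<otimes>\<^bsub>S\<^esub> h (r i)))"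
  (is "?surj \<longleftrightarrow> ?div")
proof
  assume surj: ?surj
  show ?div
  proof
    fix s assume s: "s \<in> carrier S"
    \<comment> \<open>\<open>I\<close> itself is too large, but the powers of its elements that \<open>s\<close> divides suffice.\<close>
    let ?K = "{r \<in> carrier R. s divides\<^bsub>S\<^esub> h r}"
    let ?s = "radical S (Idl\<^bsub>S\<^esub> {s})"
    have s_mem: "s \<in> ?s" and s_rad: "?s \<in> radical_ideals S"
      using S.radical_genideal_le_iff[of ?s "{s}"] s
      by (auto intro!: S.radical_radical_ideal S.genideal_ideal)
    obtain I where I: "I \<in> radical_ideals R" and Is: "push_ideal S h I = ?s"
      using surj s_rad by (metis imageE)
    have K: "?K \<subseteq> carrier R" by auto
    have "I \<subseteq> pull_ideal R h (push_ideal S h ?K)"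
    proof
      fix a assume a: "a \<in> I"
      have aR: "a \<in> carrier R" using a radical_ideals_subset[OF I] by auto
      have "h a \<in> ?s" using image_subset_push_ideal[OF radical_ideals_subset[OF I]] a Is by auto
      \<comment> \<open>Some power of \<open>h a\<close> is a multiple of \<open>s\<close>, which
        puts the same power of \<open>a\<close> into \<open>?K\<close>.\<close>
      then obtain n :: nat where "h a [^]\<^bsub>S\<^esub> n \<in> PIdl\<^bsub>S\<^esub> s"
        using S.cgenideal_eq_genideal[OF s] by (auto simp: radical_def)
      then have "a [^]\<^bsub>R\<^esub> n \<in> ?K"
        using aR s S.m_comm by (auto simp: cgenideal_def factor_def ring.hom_nat_pow)
      then have "h (a [^]\<^bsub>R\<^esub> n) \<in> push_ideal S h ?K" using image_subset_push_ideal[OF K] by blast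
      then have "a [^]\<^bsub>R\<^esub> n \<in> pull_ideal R h (push_ideal S h ?K)"
        using aR by (simp add: pull_ideal_def)
      then show "a \<in> pull_ideal R h (push_ideal S h ?K)"
        using radical_ideals_pow_mem[OF pull_ideal_radical_ideal[OF push_ideal_radical_ideal[OF K]]] aR
        by blast
    qed
    then have "push_ideal S h I \<subseteq> push_ideal S h ?K"
      using push_ideal_le_iff[OF radical_ideals_subset[OF I] push_ideal_radical_ideal[OF K]] by blast
    then have "s \<in> push_ideal S h ?K" using s_mem Is by blast
    then obtain m :: nat where m: "s [^]\<^bsub>S\<^esub> m \<in> Idl\<^bsub>S\<^esub> (h ` ?K)"
      by (auto simp: push_ideal_def radical_def)
    obtain k :: nat and b t where bt: "\<forall>i\<in>{1..k}. b i \<in> h ` ?K \<and> t i \<in> carrier S"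
      and sm: "s [^]\<^bsub>S\<^esub> m = (\<Oplus>\<^bsub>S\<^esub>i\<in>{1..k}. t i \<otimes>\<^bsub>S\<^esub> b i)"
      using S.genideal_finite_combination[OF image_subset_carrier[OF K] m] by blast
    have "\<forall>i\<in>{1..k}. \<exists>r. r \<in> ?K \<and> b i = h r" using bt by blast
    then obtain r where r: "\<forall>i\<in>{1..k}. r i \<in> ?K \<and> b i = h (r i)" unfolding bchoice_iff by blast
    have "s [^]\<^bsub>S\<^esub> m = (\<Oplus>\<^bsub>S\<^esub>i\<in>{1..k}. t i \<otimes>\<^bsub>S\<^esub> h (r i))"
      unfolding sm by (rule S.finsum_cong') (use r bt in auto)
    then show "\<exists>(k::nat) (r :: nat \<Rightarrow> 'a) (t :: nat \<Rightarrow> 'c) (m::nat).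
      (\<forall>i \<in> {1..k}. r i \<in> carrier R \<and> t i \<in> carrier S \<and> s divides\<^bsub>S\<^esub> h (r i)) \<and>
      s [^]\<^bsub>S\<^esub> m = (\<Oplus>\<^bsub>S\<^esub>i\<in>{1..k}. t i \<otimes>\<^bsub>S\<^esub> h (r i))"
      using r bt by blast
  qed
next
  assume div: ?div
  have "J \<in> push_ideal S h ` radical_ideals R" if J: "J \<in> radical_ideals S" for J
  proof -
    let ?I = "pull_ideal R h J"
    note I = pull_ideal_radical_ideal[OF J]
    note IR = radical_ideals_subset[OF I]
    interpret J: ideal J S using J by (rule radical_ideals_ideal)
    interpret P: ideal "push_ideal S h ?I" S
      using push_ideal_radical_ideal[OF IR] by (rule radical_ideals_ideal)
    have "J \<subseteq> push_ideal S h ?I"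
    proof
      fix s assume s: "s \<in> J"
      then have sS: "s \<in> carrier S" by (rule J.Icarr)
      then obtain k :: nat and r t and m :: nat where
        rt: "\<forall>i \<in> {1..k}. r i \<in> carrier R \<and> t i \<in> carrier S \<and> s divides\<^bsub>S\<^esub> h (r i)"
        and sm: "s [^]\<^bsub>S\<^esub> m = (\<Oplus>\<^bsub>S\<^esub>i\<in>{1..k}. t i \<otimes>\<^bsub>S\<^esub> h (r i))"
        using div by blast
      \<comment> \<open>As a multiple of \<open>s \<in> J\<close>, \<open>h (r i)\<close> lies in
        \<open>J\<close>, so \<open>r i\<close> lies in the inverse image.\<close>
      have "h (r i) \<in> push_ideal S h ?I" if i: "i \<in> {1..k}" for i
      proof -
        obtain c where "c \<in> carrier S" "h (r i) = s \<otimes>\<^bsub>S\<^esub> c"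
          using rt i unfolding factor_def by blast
        then have "r i \<in> ?I" using rt i J.I_r_closed[OF s] by (simp add: pull_ideal_def)
        then show ?thesis using image_subset_push_ideal[OF IR] by blast
      qed
      then have "s [^]\<^bsub>S\<^esub> m \<in> push_ideal S h ?I"
        unfolding sm using rt by (intro P.finsum_mem P.I_l_closed) auto
      then show "s \<in> push_ideal S h ?I"
        using radical_ideals_pow_mem[OF push_ideal_radical_ideal[OF IR] sS] by blast
    qed
    moreover have "push_ideal S h ?I \<subseteq> J" using push_ideal_le_iff[OF IR J] by simp
    ultimately show ?thesis using I by blast
  qed
  then show ?surj using push_ideal_radical_ideal radical_ideals_subset by blast
qed

text \<open>Surjectivity represents the radical of \<open>Idl A\<close> as the inverse image of some
  \<open>J\<close>, which then contains the ideal generated by the image of \<open>A\<close>.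
  Conversely, the condition with \<open>A = I\<close> shows that \<open>I\<close> is the inverse
  image of its direct image.\<close>

lemma pull_ideal_surj_iff:
  "pull_ideal R h ` radical_ideals S = radical_ideals R \<longleftrightarrow>
    (\<forall>A r. A \<union> {r} \<subseteq> carrier R \<longrightarrow> h r \<in> Idl\<^bsub>S\<^esub> (h ` A) \<longrightarrow>
      (\<exists>n::nat. r [^]\<^bsub>R\<^esub> n \<in> Idl\<^bsub>R\<^esub> A))"
  (is "?surj \<longleftrightarrow> ?refl")
proof
  assume surj: ?surj
  show ?refl
  proof (intro allI impI)
    fix A r assume Ar: "A \<union> {r} \<subseteq> carrier R" and hr: "h r \<in> Idl\<^bsub>S\<^esub> (h ` A)"
    have A: "A \<subseteq> carrier R" using Ar by simp
    have rad: "radical R (Idl\<^bsub>R\<^esub> A) \<in> radical_ideals R"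
      by (intro R.radical_radical_ideal R.genideal_ideal A)
    then obtain J where J: "J \<in> radical_ideals S" and JA: "pull_ideal R h J = radical R (Idl\<^bsub>R\<^esub> A)"
      using surj by (metis imageE)
    have "A \<subseteq> pull_ideal R h J" using R.radical_genideal_le_iff[OF rad A] JA by simp
    then have "Idl\<^bsub>S\<^esub> (h ` A) \<subseteq> J"
      by (intro S.genideal_minimal radical_ideals_ideal J) (auto simp: pull_ideal_def)
    then have "r \<in> pull_ideal R h J" using hr Ar by (auto simp: pull_ideal_def)
    then show "\<exists>n::nat. r [^]\<^bsub>R\<^esub> n \<in> Idl\<^bsub>R\<^esub> A" unfolding JA by (simp add: radical_def)
  qed
next
  assume refl: ?refl
  have "I \<in> pull_ideal R h ` radical_ideals S" if I: "I \<in> radical_ideals R" for I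
  proof -
    note IR = radical_ideals_subset[OF I]
    have "pull_ideal R h (push_ideal S h I) \<subseteq> I"
    proof
      fix x assume "x \<in> pull_ideal R h (push_ideal S h I)"
      then obtain n :: nat where x: "x \<in> carrier R" and "h x [^]\<^bsub>S\<^esub> n \<in> Idl\<^bsub>S\<^esub> (h ` I)"
        by (auto simp: pull_ideal_def push_ideal_def radical_def)
      then have "h (x [^]\<^bsub>R\<^esub> n) \<in> Idl\<^bsub>S\<^esub> (h ` I)" by (simp add: ring.hom_nat_pow)
      \<comment> \<open>Here \<open>refl\<close> is applied with \<open>A = I\<close> and
        \<open>r = x [^] n\<close>; the two exponents are then removed in turn because
        \<open>I\<close> is radical.\<close>
      then obtain m :: nat where "(x [^]\<^bsub>R\<^esub> n) [^]\<^bsub>R\<^esub> m \<in> Idl\<^bsub>R\<^esub> I"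
        using refl IR x by (metis Un_insert_right insert_subset R.nat_pow_closed sup_bot.right_neutral)
      then have "(x [^]\<^bsub>R\<^esub> n) [^]\<^bsub>R\<^esub> m \<in> I"
        using R.genideal_minimal[OF radical_ideals_ideal[OF I], of I] by blast
      then show "x \<in> I" using radical_ideals_pow_mem[OF I] x by (metis R.nat_pow_closed)
    qed
    moreover have "I \<subseteq> pull_ideal R h (push_ideal S h I)"
      using push_ideal_le_iff[OF IR push_ideal_radical_ideal[OF IR]] by simp
    ultimately show ?thesis using push_ideal_radical_ideal[OF IR] by blast
  qed
  then show ?surj using pull_ideal_radical_ideal by blast
qed

end

section \<open>The nabla-algebra of radical ideals\<close>

text \<open>Primes are proper, so \<open>open_of S (carrier S)\<close> is all of
  \<open>Spec S\<close> and its preimage all of \<open>Spec R\<close>. With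
  \<open>push_ideal_carrier\<close> this makes nabla preserve the top.\<close>

lemma (in cring) hat_carrier:
  assumes "\<And>P. P \<in> Spec R \<Longrightarrow> F P \<in> Spec S"
  shows "hat R S F (carrier S) = carrier R"
proof -
  have "\<exists>x\<in>carrier S. x \<notin> P" if "P \<in> Spec S" for P
  proof -
    interpret P: primeideal P S using that by (simp add: Spec_def)
    show ?thesis using P.I_notcarr P.Icarr by blast
  qed
  then have "open_of S (carrier S) = Spec S" by (auto simp: open_of_def)
  then show ?thesis using assms by (auto simp: hat_def ideal_of_def)
qed

text \<open>An injection can be cancelled from an equality of images; this strips the homeomorphism
  from the faithfulness condition.\<close>

lemma image_comp_eq_iff_surj:
  assumes "bij_betw e B A" and "u ` C \<subseteq> B"
  shows "(\<lambda>x. e (u x)) ` C = A \<longleftrightarrow> u ` C = B"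
proof -
  have "(\<lambda>x. e (u x)) ` C = e ` (u ` C)" by auto
  then show ?thesis
    using assms inj_on_image_eq_iff[of e B "u ` C" B] by (auto simp: bij_betw_def)
qed

theorem theorem5p5:
  fixes R :: "('a, 'm) ring_scheme" and S :: "('b, 'n) ring_scheme"
    and \<pi> :: "'a \<Rightarrow> 'b" and f :: "'a set \<Rightarrow> 'b set" and g :: "'b set \<Rightarrow> 'a set"
  assumes "cring R" and "cring S" and "\<pi> \<in> ring_hom R S"
    and "homeomorphic_maps (Spec_topology R) (Spec_topology S) f g"
  shows "normal_nabla_algebra (RI R) (RI_nabla R S \<pi> f) (RI_imp R S \<pi> g) \<and>
    (faithful_nabla_algebra (RI R) (RI_nabla R S \<pi> f) (RI_imp R S \<pi> g) \<longleftrightarrow>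
      (\<forall>s \<in> carrier S. \<exists>(k::nat) (r :: nat \<Rightarrow> 'a) (t :: nat \<Rightarrow> 'b) (m::nat).
        (\<forall>i \<in> {1..k}. r i \<in> carrier R \<and> t i \<in> carrier S \<and> s divides\<^bsub>S\<^esub> \<pi> (r i)) \<and>
        s [^]\<^bsub>S\<^esub> m = (\<Oplus>\<^bsub>S\<^esub>i\<in>{1..k}. t i \<otimes>\<^bsub>S\<^esub> \<pi> (r i)))) \<and>
    (full_nabla_algebra (RI R) (RI_nabla R S \<pi> f) (RI_imp R S \<pi> g) \<longleftrightarrow>
      (\<forall>A r. A \<union> {r} \<subseteq> carrier R \<longrightarrow> \<pi> r \<in> Idl\<^bsub>S\<^esub> (\<pi> ` A) \<longrightarrow>
        (\<exists>n::nat. r [^]\<^bsub>R\<^esub> n \<in> Idl\<^bsub>R\<^esub> A)))"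
proof -
  interpret R: cring R by fact
  interpret S: cring S by fact
  interpret \<pi>: ring_hom_cring R S \<pi> by unfold_locales fact
  interpret L: bounded_lattice "RI R" by (rule R.RI_bounded_lattice)
  note fg = assms(4) and gf = assms(4)[unfolded homeomorphic_maps_sym[of "Spec_topology R"]]
  note hat_fg = hat_hat[OF assms(1,2) fg] and hat_gf = hat_hat[OF assms(2,1) gf]
  let ?nabla = "RI_nabla R S \<pi> f" and ?imp = "RI_imp R S \<pi> g"
  have f_Spec: "f P \<in> Spec S" if "P \<in> Spec R" for P
    using fg that topspace_Spec_topology[OF assms(1)] topspace_Spec_topology[OF assms(2)]
    by (auto simp: homeomorphic_maps_def continuous_map_def)
  have bij_f: "bij_betw (hat R S f) (radical_ideals S) (radical_ideals R)"
    by (rule bij_betw_byWitness[where f' = "hat S R g"])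
      (auto simp: hat_fg hat_gf R.hat_radical_ideal S.hat_radical_ideal)
  have bij_g: "bij_betw (hat S R g) (radical_ideals R) (radical_ideals S)"
    by (rule bij_betw_byWitness[where f' = "hat R S f"])
      (auto simp: hat_fg hat_gf R.hat_radical_ideal S.hat_radical_ideal)
  \<comment> \<open>Monotone mutually inverse maps are adjoint.\<close>
  have hat_le: "hat R S f I \<subseteq> J \<longleftrightarrow> I \<subseteq> hat S R g J"
    if "I \<in> radical_ideals S" "J \<in> radical_ideals R" for I J
    using that hat_mono[of "hat R S f I" J S R g] hat_mono[of I "hat S R g J" R S f]
    by (auto simp: hat_fg hat_gf)
  \<comment> \<open>For the nontrivial inclusion, \<open>?H\<close> is moved over by
    \<open>hat S R g\<close>, bounded there by both \<open>I\<close> and \<open>J\<close>, and moved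
    back.\<close>
  have hat_Int: "hat R S f (I \<inter> J) = hat R S f I \<inter> hat R S f J"
    if I: "I \<in> radical_ideals S" and J: "J \<in> radical_ideals S" for I J
  proof
    have "hat R S f I \<inter> hat R S f J \<in> radical_ideals R" (is "?H \<in> _")
      by (intro R.Int_radical_ideals R.hat_radical_ideal)
    moreover have "hat S R g ?H \<subseteq> I \<inter> J"
      using hat_mono[of ?H "hat R S f I" S R g] hat_mono[of ?H "hat R S f J" S R g]
      by (simp add: hat_gf I J)
    ultimately show "?H \<subseteq> hat R S f (I \<inter> J)"
      using hat_mono[of "hat S R g ?H" "I \<inter> J" R S f] by (simp add: hat_fg)
  qed (simp add: hat_mono)
  have push: "push_ideal S \<pi> I \<in> radical_ideals S" if "I \<in> radical_ideals R" for I
    using that by (intro \<pi>.push_ideal_radical_ideal radical_ideals_subset)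
  have normal: "normal_nabla_algebra (RI R) ?nabla ?imp"
  proof unfold_locales
    show "?nabla a \<in> carrier (RI R)" if "a \<in> carrier (RI R)" for a
      by (simp add: RI_nabla_def R.hat_radical_ideal)
    show "?imp a b \<in> carrier (RI R)" if "a \<in> carrier (RI R)" "b \<in> carrier (RI R)" for a b
      by (simp add: RI_imp_def S.hat_radical_ideal \<pi>.pull_ideal_radical_ideal)
    show "?nabla \<top>\<^bsub>RI R\<^esub> = \<top>\<^bsub>RI R\<^esub>"
      by (simp add: RI_nabla_def R.RI_top \<pi>.push_ideal_carrier R.hat_carrier f_Spec)
    show "?nabla (a \<sqinter>\<^bsub>RI R\<^esub> b) = ?nabla a \<sqinter>\<^bsub>RI R\<^esub> ?nabla b"
      if "a \<in> carrier (RI R)" "b \<in> carrier (RI R)" for a b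
      using that by (simp add: RI_nabla_def R.RI_meet R.hat_radical_ideal hat_Int push
          \<pi>.push_ideal_Int radical_ideals_ideal)
    fix a b c assume "a \<in> carrier (RI R)" "b \<in> carrier (RI R)" "c \<in> carrier (RI R)"
    then have a: "a \<in> radical_ideals R" and b: "b \<in> radical_ideals R" and c: "c \<in> radical_ideals R"
      by simp_all
    have q: "ideal_quotient R b a \<in> radical_ideals R"
      using b radical_ideals_subset[OF a] by (rule R.ideal_quotient_radical_ideal)
    \<comment> \<open>The chain peels off the colon, the homeomorphism and the ring homomorphism in
      this order.\<close>
    have "?nabla c \<inter> a \<subseteq> b \<longleftrightarrow> hat R S f (push_ideal S \<pi> c) \<subseteq> ideal_quotient R b a"
      unfolding RI_nabla_def by (rule R.radical_ideal_Int_le_iff[OF R.hat_radical_ideal a b])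
    also have "\<dots> \<longleftrightarrow> push_ideal S \<pi> c \<subseteq> hat S R g (ideal_quotient R b a)"
      by (rule hat_le[OF push[OF c] q])
    also have "\<dots> \<longleftrightarrow> c \<subseteq> ?imp a b"
      unfolding RI_imp_def
      by (rule \<pi>.push_ideal_le_iff[OF radical_ideals_subset[OF c] S.hat_radical_ideal])
    finally show "?nabla c \<sqinter>\<^bsub>RI R\<^esub> a \<sqsubseteq>\<^bsub>RI R\<^esub> b \<longleftrightarrow> c \<sqsubseteq>\<^bsub>RI R\<^esub> ?imp a b"
      using a by (simp add: R.RI_meet RI_nabla_def R.hat_radical_ideal)
  qed
  then have nabla: "nabla_algebra (RI R) ?nabla ?imp" by (rule normal_nabla_algebra.axioms)
  have "faithful_nabla_algebra (RI R) ?nabla ?imp \<longleftrightarrow>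
      (\<lambda>I. hat R S f (push_ideal S \<pi> I)) ` radical_ideals R = radical_ideals R"
    using nabla by (simp add: faithful_nabla_algebra_def faithful_nabla_algebra_axioms_def
        RI_nabla_def[abs_def])
  also have "\<dots> \<longleftrightarrow> push_ideal S \<pi> ` radical_ideals R = radical_ideals S"
    by (rule image_comp_eq_iff_surj[OF bij_f]) (use push in auto)
  finally have faithful: "faithful_nabla_algebra (RI R) ?nabla ?imp \<longleftrightarrow>
      push_ideal S \<pi> ` radical_ideals R = radical_ideals S" .
  have "(\<lambda>J. ?imp \<top>\<^bsub>RI R\<^esub> J) ` radical_ideals R = (\<lambda>J. pull_ideal R \<pi> (hat S R g J)) ` radical_ideals R"
    by (intro image_cong) (simp_all add: RI_imp_def R.RI_top R.ideal_quotient_carrier radical_ideals_ideal)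
  \<comment> \<open>The map \<open>hat S R g\<close> is onto \<open>radical_ideals S\<close>, so it
    drops out of the image.\<close>
  also have "\<dots> = pull_ideal R \<pi> ` radical_ideals S"
    using bij_g by (simp add: bij_betw_def flip: image_image)
  finally have full: "full_nabla_algebra (RI R) ?nabla ?imp \<longleftrightarrow>
      pull_ideal R \<pi> ` radical_ideals S = radical_ideals R"
    using nabla by (simp add: full_nabla_algebra_def full_nabla_algebra_axioms_def)
  show ?thesis
    using normal unfolding faithful full \<pi>.push_ideal_surj_iff \<pi>.pull_ideal_surj_iff by blast
qed

end
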